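(* Let $x^*\in\{0,\pm1\}^d$, $S:=\operatorname{supp}(x^* )$, and assume $|S|=\sigma$. Define $y^*:=-M^\top b/n$ and $Y_{11}^*:=-(y_S^* )^\top x_S^*$, and assume $Y_{11}^*>0$. Let $\theta:=\arccos\Big(\frac{(y_S^* )^\top x_S^*}{\sqrt\sigma\|y_S^*\|_2}\Big)$. Then (SILS'-SDP) recovers $x^*$ if there exists a constant $\delta>0$ such that, with $$\mu_3^*:=\frac1\sigma\Big\{\lambda_{\min}\Big(\frac1n(M^\top M)_{S,S}\Big)-\delta+\min_{i\in S}\Big[-y_S^*-\frac1n(M^\top M)_{S,S}x_S^*\Big]_i\big/x_i^*\Big\},$$ the following two conditions are satisfied: (B1) $\Big\|\frac1n(M^\top M)_{S^c,S}+\frac1\sigma y_{S^c}^*(x_S^* )^\top\Big\|_\infty\le\mu_3^*$; (B2) there exists $\mu_2^*\le-\lambda_{\min}\big(\frac1n(M^\top M)_{S,S}\big)+\delta$ such that $$\Big\|\frac1n(M^\top M)_{S^c,S^c}+\mu_2^*I_{d-\sigma}\Big\|_\infty+\Big\|\frac1{Y_{11}^*}y_{S^c}^*(y_{S^c}^* )^\top\Big\|_\infty+\frac{1-\cos^2(\theta)}{\sigma\delta\cos^2(\theta)}\|y_{S^c}^*\|_\infty^2<\mu_3^*.$$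
   Context: $n,d,\sigma$ are positive integers with $\sigma\le d$, $M\in\mathbb{R}^{n\times d}$, $b\in\mathbb{R}^n$, and $A:=\begin{pmatrix}-b&M\end{pmatrix}\in\mathbb{R}^{n\times(1+d)}$. (SILS'-SDP): minimize $\frac1n\operatorname{tr}(A^\top AW)$ over symmetric positive semidefinite $W\in\mathbb{R}^{(1+d)\times(1+d)}$ subject to $W_{11}=1$, $\operatorname{tr}(W_x)=\sigma$, $1_d^\top|W_x|1_d\le\sigma^2$, $\operatorname{diag}(W_x)\le1_d$ (entrywise), where $W_x$ is $W$ with first row and column deleted, $|W_x|$ is the entrywise absolute value, and $1_d$ is the all-ones vector. It is a relaxation of (SILS'): minimize $\frac1n\|Mx-b\|_2^2$ over $x\in\{0,\pm1\}^d$ with exactly $\sigma$ nonzero entries. "(SILS'-SDP) recovers $x^*$" means: $x^*\in\{0,\pm1\}^d$ and (SILS'-SDP) has a unique optimal solution, namely the rank-one matrix $W^*=\begin{pmatrix}1 \\ x^*\end{pmatrix}\begin{pmatrix}1 \\ x^*\end{pmatrix}^\top$. Notation: $\operatorname{supp}(x)=\{i:x_i\ne0\}$; $S^c=\{1,\dots,d\}\setminus S$; $v_I$ and $N_{I,J}$ denote the subvector and submatrix with the indicated indices; $\|\cdot\|_\infty$ is the largest absolute value of an entry of a vector or matrix ($0$ for an empty one); $\lambda_{\min}$ is the smallest eigenvalue. *)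

theory Defs
  imports "HOL-Analysis.Analysis"
begin

(* R^n and R^d are real^'n and real^'d; the index set {1,...,1+d} is 'd option,
   with None as the distinguished first index. Subvectors and submatrices with indices
   in I, J are not separate objects: operations on them take the index sets as arguments. *)

definition data_matrix :: "real^'d^'n \<Rightarrow> real^'n \<Rightarrow> real^('d::finite) option^'n" where
  "data_matrix M b = (\<chi> i j. case j of None \<Rightarrow> - b $ i | Some k \<Rightarrow> M $ i $ k)"

definition delete_first :: "real^('d::finite) option^('d::finite) option \<Rightarrow> real^'d^'d" where
  "delete_first W = (\<chi> i j. W $ Some i $ Some j)"

definition outer :: "real^'a \<Rightarrow> real^'b \<Rightarrow> real^'b^'a" where
  "outer u v = (\<chi> i j. u $ i * v $ j)"

definition pos_semidef :: "real^'a^'a \<Rightarrow> bool" where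
  "pos_semidef W \<longleftrightarrow> transpose W = W \<and> (\<forall>v. v \<bullet> (W *v v) \<ge> 0)"

definition sdp_feasible :: "nat \<Rightarrow> real^('d::finite) option^('d::finite) option \<Rightarrow> bool" where
  "sdp_feasible \<sigma> W \<longleftrightarrow>
     pos_semidef W \<and>
     W $ None $ None = 1 \<and>
     trace (delete_first W) = real \<sigma> \<and>
     (\<Sum>i\<in>UNIV. \<Sum>j\<in>UNIV. \<bar>delete_first W $ i $ j\<bar>) \<le> (real \<sigma>)\<^sup>2 \<and>
     (\<forall>i. delete_first W $ i $ i \<le> 1)"

definition sdp_objective ::
    "real^'d^'n \<Rightarrow> real^'n \<Rightarrow> real^('d::finite) option^('d::finite) option \<Rightarrow> real" where
  "sdp_objective M b W =
     (1 / real CARD('n)) *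
       trace (transpose (data_matrix M b) ** data_matrix M b ** W)"

definition sdp_optimal ::
    "real^'d^'n \<Rightarrow> real^'n \<Rightarrow> nat \<Rightarrow> real^('d::finite) option^('d::finite) option \<Rightarrow> bool" where
  "sdp_optimal M b \<sigma> W \<longleftrightarrow>
     sdp_feasible \<sigma> W \<and>
     (\<forall>V. sdp_feasible \<sigma> V \<longrightarrow> sdp_objective M b W \<le> sdp_objective M b V)"

definition prepend_one :: "real^'d \<Rightarrow> real^('d::finite) option" where
  "prepend_one x = (\<chi> j. case j of None \<Rightarrow> 1 | Some k \<Rightarrow> x $ k)"

definition sdp_recovers :: "real^'d^'n \<Rightarrow> real^'n \<Rightarrow> nat \<Rightarrow> real^'d \<Rightarrow> bool" where
  "sdp_recovers M b \<sigma> x \<longleftrightarrow>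
     (\<forall>i. x $ i \<in> {-1, 0, 1}) \<and>
     {W. sdp_optimal M b \<sigma> W} = {outer (prepend_one x) (prepend_one x)}"

definition supp :: "real^'d \<Rightarrow> 'd set" where
  "supp x = {i. x $ i \<noteq> 0}"

definition inf_norm_vec :: "'a set \<Rightarrow> real^'a \<Rightarrow> real" where
  "inf_norm_vec I v = Max (insert 0 ((\<lambda>i. \<bar>v $ i\<bar>) ` I))"

definition inf_norm_mat :: "'a set \<Rightarrow> 'b set \<Rightarrow> real^'b^'a \<Rightarrow> real" where
  "inf_norm_mat I J N = Max (insert 0 ((\<lambda>(i, j). \<bar>N $ i $ j\<bar>) ` (I \<times> J)))"

(* Eigenvalues of the principal submatrix N_{S,S}; only the values of v on S matter. *)
definition principal_eigenvalue :: "'a set \<Rightarrow> real^'a^'a \<Rightarrow> real \<Rightarrow> bool" where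
  "principal_eigenvalue S N l \<longleftrightarrow>
     (\<exists>v :: 'a \<Rightarrow> real. (\<exists>i\<in>S. v i \<noteq> 0) \<and>
        (\<forall>i\<in>S. (\<Sum>j\<in>S. N $ i $ j * v j) = l * v i))"

(* Only meaningful when N_{S,S} has a real eigenvalue, e.g. for symmetric N and nonempty S. *)
definition lambda_min :: "'a set \<Rightarrow> real^'a^'a \<Rightarrow> real" where
  "lambda_min S N = (LEAST l. principal_eigenvalue S N l)"

end

theory Submission
  imports Defs
begin

text \<open>Dual certificate. Take the Lagrangian matrix with multiplier \<open>\<mu>2\<close> for the trace, \<open>p\<close> for the
  diagonal and \<open>E = \<mu>3 Z\<close> for the \<open>l\<^sub>1\<close>-constraint, where \<open>Z\<close> equals \<open>x x\<^sup>T\<close> on \<open>S \<times> S\<close>, is chosen on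
  \<open>S\<^sup>c \<times> S\<close> so that this block of the Lagrangian matrix becomes \<open>- y x\<^sup>T / \<sigma>\<close>, and on
  \<open>S\<^sup>c \<times> S\<^sup>c\<close> so that it becomes the rank-one matrix \<open>(1 / Y11 + c) y y\<^sup>T\<close>. The constant
  \<open>c = (1 - cos\<^sup>2 \<theta>) / (\<sigma> \<delta> cos\<^sup>2 \<theta>)\<close> is exactly what the Schur complement needs for positive
  semidefiniteness. Condition (B1) bounds \<open>Z\<close> on \<open>S\<^sup>c \<times> S\<close>, and the strict inequality (B2) on
  \<open>S\<^sup>c \<times> S\<^sup>c\<close> forces optimal matrices to vanish there; writing such a matrix as a Gram matrix, each
  Gram vector is then a multiple of \<open>(1, x)\<close>.\<close>

section \<open>Positive semidefinite forms and Gram decompositions\<close>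

text \<open>For \<open>0 < r\<close> the minimum over \<open>a\<close> is attained at
  \<open>- q / r\<close> and equals \<open>p - q\<^sup>2 / r\<close>. It is applied twice: to get
  Cauchy-Schwarz for semidefinite forms, and with \<open>p = 0\<close> as a first-order condition at
  a minimiser.\<close>

lemma quadratic_nonneg_discrim:
  fixes p q r :: real
  assumes "\<And>a. 0 \<le> p + 2 * a * q + a\<^sup>2 * r"
  shows "q\<^sup>2 \<le> p * r"
proof (cases "r = 0")
  case True
  have "q = 0"
  proof (rule ccontr)
    assume "q \<noteq> 0"
    then show False
      \<comment> \<open>At this \<open>a\<close> the affine function takes the value -1.\<close>
      using assms[of "- (p + 1) / (2 * q)"] True by (simp add: field_simps)
  qed
  then show ?thesis using True by simp
next
  case False
  have "0 \<le> r"
  proof (rule ccontr)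
    assume neg: "\<not> 0 \<le> r"
    have *: "0 \<le> p + a\<^sup>2 * r" for a
      using assms[of a] assms[of "- a"] by simp
    \<comment> \<open>Adding the inequalities at \<open>a\<close> and \<open>- a\<close> removed the
      linear term; at \<open>a\<^sup>2 = c\<close> what is left is
      \<open>p + r - \<bar>p\<bar>\<close>, at most \<open>r\<close> and hence negative.\<close>
    define c where "c = 1 + \<bar>p\<bar> / (- r)"
    have "0 \<le> c" using neg by (simp add: c_def)
    then have "0 \<le> p + c * r" using *[of "sqrt c"] by simp
    moreover have "c * r = r - \<bar>p\<bar>" using neg by (simp add: c_def field_simps)
    ultimately show False using neg by linarith
  qed
  then have "0 < r" using False by simp
  have "0 \<le> p + 2 * (- q / r) * q + (- q / r)\<^sup>2 * r" by (rule assms)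
  also have "\<dots> = p - q\<^sup>2 / r"
    using False by (simp add: field_simps power2_eq_square)
  finally show ?thesis using \<open>0 < r\<close> by (simp add: field_simps)
qed

lemma inner_matrix_symmetric:
  fixes W :: "real^'a^'a"
  assumes "transpose W = W"
  shows "v \<bullet> (W *v w) = w \<bullet> (W *v v)"
  by (metis assms dot_lmul_matrix inner_commute vector_transpose_matrix)

lemma pos_semidef_cauchy_schwarz:
  fixes W :: "real^'a^'a"
  assumes "pos_semidef W"
  shows "(v \<bullet> (W *v w))\<^sup>2 \<le> (v \<bullet> (W *v v)) * (w \<bullet> (W *v w))"
proof (rule quadratic_nonneg_discrim)
  fix a :: real
  have "0 \<le> (v + a *\<^sub>R w) \<bullet> (W *v (v + a *\<^sub>R w))"
    using assms unfolding pos_semidef_def by blast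
  also have "\<dots> = v \<bullet> (W *v v) + 2 * a * (v \<bullet> (W *v w)) + a\<^sup>2 * (w \<bullet> (W *v w))"
    using inner_matrix_symmetric[of W w v] assms
    by (simp add: pos_semidef_def matrix_vector_right_distrib matrix_vector_mult_scaleR
        inner_add_left inner_add_right power2_eq_square algebra_simps)
  finally show "0 \<le> v \<bullet> (W *v v) + 2 * a * (v \<bullet> (W *v w)) + a\<^sup>2 * (w \<bullet> (W *v w))" .
qed

lemma outer_mult_vector: "outer u v *v w = (v \<bullet> w) *\<^sub>R u"
  by (simp add: outer_def matrix_vector_mult_def vec_eq_iff inner_vec_def sum_distrib_right
      sum_distrib_left algebra_simps)

lemma inner_axis_matrix: "axis i 1 \<bullet> (W *v axis j 1) = (W :: real^'a^'a) $ i $ j"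
  by (simp add: inner_axis' matrix_vector_mult_basis column_def)

text \<open>One elimination pivot per index, as in a Cholesky factorisation: subtracting the
  rank-one matrix of column \<open>k\<close> keeps the form nonnegative by Cauchy-Schwarz and clears
  row \<open>k\<close>, so that the remaining nonzero rows lie in the smaller index set.\<close>

lemma pos_semidef_gram_aux:
  fixes W :: "real^'a^'a"
  assumes "finite I" "pos_semidef W" "\<forall>i j. i \<notin> I \<longrightarrow> W $ i $ j = 0"
  shows "\<exists>z. \<forall>i j. W $ i $ j = (\<Sum>k\<in>I. z k $ i * z k $ j :: real)"
  using assms
proof (induction I arbitrary: W rule: finite_induct)
  case empty
  then show ?case by simp
next
  case (insert k I)
  let ?w = "W $ k $ k"
  let ?c = "W *v axis k 1"
  \<comment> \<open>A zero pivot fits the same formula: division by zero gives \<open>V = W\<close>,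
    and Cauchy-Schwarz shows that column \<open>k\<close> vanishes already.\<close>
  define V where "V = W - (1 / ?w) *\<^sub>R outer ?c ?c"
  have sym: "transpose W = W" using insert.prems(1) by (simp add: pos_semidef_def)
  then have sym': "W $ i $ j = W $ j $ i" for i j
    by (metis transpose_def vec_lambda_beta)
  have c: "?c $ i = W $ i $ k" for i
    by (simp add: matrix_vector_mult_basis column_def)
  have w0: "0 \<le> ?w"
    using insert.prems(1) inner_axis_matrix[of k W k] unfolding pos_semidef_def by metis
  have cs: "(v \<bullet> ?c)\<^sup>2 \<le> (v \<bullet> (W *v v)) * ?w" for v
    using pos_semidef_cauchy_schwarz[OF insert.prems(1), of v "axis k 1"]
    by (simp only: inner_axis_matrix)
  have c0: "?c = 0" if "?w = 0"
    using cs[of ?c] that by simp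
  have V: "V $ i $ j = W $ i $ j - W $ i $ k * W $ j $ k / ?w" for i j
    by (simp add: V_def outer_def c)
  have "pos_semidef V"
    unfolding pos_semidef_def
  proof (intro conjI allI)
    show "transpose V = V"
      by (simp add: transpose_def vec_eq_iff V sym' mult.commute)
  next
    fix v
    have "v \<bullet> (V *v v) = v \<bullet> (W *v v) - (v \<bullet> ?c)\<^sup>2 / ?w"
      by (simp add: V_def matrix_vector_mult_diff_rdistrib scaleR_matrix_vector_assoc[symmetric]
          outer_mult_vector inner_diff_right power2_eq_square inner_commute)
    also have "\<dots> \<ge> 0"
      using cs[of v] w0 insert.prems(1)
      by (cases "?w = 0") (auto simp: pos_semidef_def field_simps)
    finally show "0 \<le> v \<bullet> (V *v v)" .
  qed
  moreover have "V $ i $ j = 0" if "i \<notin> I" for i j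
  proof (cases "i = k")
    case True
    then show ?thesis using c0 c[of j] sym'[of k j] by (cases "?w = 0") (auto simp: V)
  next
    case False
    then show ?thesis using that insert.prems(2) by (simp add: V)
  qed
  ultimately obtain z where z: "\<And>i j. V $ i $ j = (\<Sum>k\<in>I. z k $ i * z k $ j)"
    using insert.IH[of V] by blast
  define z' where "z' = z(k := (1 / sqrt ?w) *\<^sub>R ?c)"
  have "W $ i $ j = (\<Sum>k\<in>insert k I. z' k $ i * z' k $ j)" for i j
  proof -
    have "(\<Sum>l\<in>I. z' l $ i * z' l $ j) = (\<Sum>l\<in>I. z l $ i * z l $ j)"
      using insert.hyps(2) by (intro sum.cong) (auto simp: z'_def)
    moreover have "z' k $ i * z' k $ j = W $ i $ k * W $ j $ k / ?w"
      using w0 by (simp add: z'_def c)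
    ultimately show ?thesis
      using insert.hyps z[of i j] V[of i j] by simp
  qed
  then show ?case by blast
qed

lemma pos_semidef_gram:
  fixes W :: "real^'a^'a"
  assumes "pos_semidef W"
  obtains z :: "'a \<Rightarrow> real^'a" where "\<And>i j. W $ i $ j = (\<Sum>k\<in>UNIV. z k $ i * z k $ j)"
  using pos_semidef_gram_aux[of UNIV W] assms by auto

section \<open>Smallest eigenvalue of a principal submatrix\<close>

lemma sum_eq_sum_restrict:
  fixes S :: "'a::finite set"
  assumes "\<And>i. i \<notin> S \<Longrightarrow> f i = 0"
  shows "sum f UNIV = sum f S"
  using assms by (intro sum.mono_neutral_right) auto

lemma inner_matrix_vector:
  "v \<bullet> (G *v w) = (\<Sum>i\<in>UNIV. \<Sum>j\<in>UNIV. (G :: real^'a^'b) $ i $ j * v $ i * w $ j)"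
  by (simp add: inner_vec_def matrix_vector_mult_def sum_distrib_left algebra_simps)

text \<open>By compactness the form has a minimum \<open>m\<close> on the unit sphere of the
  coordinate subspace of \<open>S\<close>. A minimiser is an eigenvector for \<open>m\<close>, and
  every eigenvalue is the Rayleigh quotient of its eigenvector, hence at least \<open>m\<close>. So
  the \<open>LEAST\<close> in \<open>lambda_min\<close> exists and equals \<open>m\<close>.\<close>

lemma lambda_min_rayleigh:
  fixes G :: "real^'a^'a"
  assumes sym: "transpose G = G" and S: "S \<noteq> {}" and v: "\<And>i. i \<notin> S \<Longrightarrow> v $ i = 0"
  shows "lambda_min S G * (v \<bullet> v) \<le> v \<bullet> (G *v v)"
proof -
  define V where "V = {v :: real^'a. \<forall>i. i \<notin> S \<longrightarrow> v $ i = 0}"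
  have closed: "closed V"
  proof -
    have "V = (\<Inter>i\<in>-S. {v. v $ i = 0})" unfolding V_def by auto
    moreover have "closed {v :: real^'a. v $ i = 0}" for i
      by (intro closed_Collect_eq continuous_intros)
    ultimately show ?thesis by auto
  qed
  have V_lin: "a *\<^sub>R u + c *\<^sub>R w \<in> V" if "u \<in> V" "w \<in> V" for a c u w
    using that by (auto simp: V_def)
  obtain i0 where "i0 \<in> S" using S by blast
  then have i0: "axis i0 1 \<in> V" "norm (axis i0 (1::real)) = 1"
    by (auto simp: V_def norm_axis_1) (auto simp: axis_def)
  have "compact (V \<inter> sphere 0 1)" using closed compact_sphere by (rule closed_Int_compact)
  moreover have "V \<inter> sphere 0 1 \<noteq> {}" using i0 by auto
  moreover have "continuous_on (V \<inter> sphere 0 1) (\<lambda>v. v \<bullet> (G *v v))"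
    by (intro continuous_intros matrix_vector_mult_linear_continuous_on)
  ultimately obtain v0 where v0: "v0 \<in> V" "norm v0 = 1"
    and min: "\<And>w. w \<in> V \<Longrightarrow> norm w = 1 \<Longrightarrow> v0 \<bullet> (G *v v0) \<le> w \<bullet> (G *v w)"
    using continuous_attains_inf[of "V \<inter> sphere 0 1" "\<lambda>v. v \<bullet> (G *v v)"]
    by (metis (no_types, lifting) IntE IntI mem_sphere_0)
  define m where "m = v0 \<bullet> (G *v v0)"
  have ray: "m * (w \<bullet> w) \<le> w \<bullet> (G *v w)" if "w \<in> V" for w
  proof (cases "w = 0")
    case False
    let ?u = "(1 / norm w) *\<^sub>R w"
    have "m \<le> ?u \<bullet> (G *v ?u)"
      using V_lin[OF that that, of "1 / norm w" 0] False unfolding m_def by (intro min) auto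
    also have "\<dots> = w \<bullet> (G *v w) / (norm w)\<^sup>2"
      by (simp add: matrix_vector_mult_scaleR power2_eq_square)
    finally show ?thesis
      using False by (simp add: field_simps power2_norm_eq_inner)
  qed simp
  \<comment> \<open>Stationarity of the minimiser: along \<open>v0 + a *\<^sub>R w\<close> the form
    minus \<open>m\<close> times the squared norm is a nonnegative quadratic in \<open>a\<close>
    with constant term 0, so its linear coefficient vanishes.\<close>
  have orth: "w \<bullet> (G *v v0) = m * (w \<bullet> v0)" if "w \<in> V" for w
  proof -
    have "(w \<bullet> (G *v v0) - m * (w \<bullet> v0))\<^sup>2 \<le> 0 * (w \<bullet> (G *v w) - m * (w \<bullet> w))"
    proof (rule quadratic_nonneg_discrim)
      fix a :: real
      have "m * ((v0 + a *\<^sub>R w) \<bullet> (v0 + a *\<^sub>R w)) \<le> (v0 + a *\<^sub>R w) \<bullet> (G *v (v0 + a *\<^sub>R w))"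
        using ray V_lin[OF v0(1) that, of 1 a] by simp
      moreover have "v0 \<bullet> v0 = 1" using v0(2) by (simp add: norm_eq_1)
      moreover have "v0 \<bullet> (G *v w) = w \<bullet> (G *v v0)" using sym by (rule inner_matrix_symmetric)
      ultimately show "0 \<le> 0 + 2 * a * (w \<bullet> (G *v v0) - m * (w \<bullet> v0))
          + a\<^sup>2 * (w \<bullet> (G *v w) - m * (w \<bullet> w))"
        by (simp add: matrix_vector_right_distrib matrix_vector_mult_scaleR inner_add_left
            inner_add_right power2_eq_square m_def[symmetric] inner_commute[of v0 w] algebra_simps)
    qed
    then show ?thesis by simp
  qed
  have "principal_eigenvalue S G m"
    unfolding principal_eigenvalue_def
  proof (intro exI[of _ "\<lambda>i. v0 $ i"] conjI ballI)
    show "\<exists>i\<in>S. v0 $ i \<noteq> 0"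
    proof (rule ccontr)
      assume "\<not> ?thesis"
      then have "v0 = 0" using v0(1) by (auto simp: V_def vec_eq_iff)
      then show False using v0(2) by simp
    qed
  next
    fix i assume "i \<in> S"
    then have "axis i 1 \<in> V" by (auto simp: V_def axis_def)
    from orth[OF this] have "(\<Sum>j\<in>UNIV. G $ i $ j * v0 $ j) = m * v0 $ i"
      by (simp add: inner_axis' matrix_vector_mult_def)
    moreover have "(\<Sum>j\<in>UNIV. G $ i $ j * v0 $ j) = (\<Sum>j\<in>S. G $ i $ j * v0 $ j)"
      using v0(1) by (intro sum_eq_sum_restrict) (auto simp: V_def)
    ultimately show "(\<Sum>j\<in>S. G $ i $ j * v0 $ j) = m * v0 $ i" by simp
  qed
  moreover have "m \<le> l" if eig: "principal_eigenvalue S G l" for l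
  proof -
    from eig obtain g where g: "\<exists>i\<in>S. g i \<noteq> 0"
      "\<And>i. i \<in> S \<Longrightarrow> (\<Sum>j\<in>S. G $ i $ j * g j) = l * g i"
      unfolding principal_eigenvalue_def by blast
    define w :: "real^'a" where "w = (\<chi> i. if i \<in> S then g i else 0)"
    have wV: "w \<in> V" by (simp add: w_def V_def)
    have "(G *v w) $ i = l * w $ i" if "i \<in> S" for i
    proof -
      have "(G *v w) $ i = (\<Sum>j\<in>S. G $ i $ j * w $ j)"
        unfolding matrix_vector_mult_def by (simp, intro sum_eq_sum_restrict) (simp add: w_def)
      also have "\<dots> = l * g i" using g(2)[OF that] by (simp add: w_def)
      finally show ?thesis using that by (simp add: w_def)
    qed
    then have "w $ i * (G *v w) $ i = l * (w $ i * w $ i)"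
      for i by (cases "i \<in> S") (simp_all add: w_def)
    then have "w \<bullet> (G *v w) = l * (w \<bullet> w)"
      unfolding inner_vec_def sum_distrib_left by (intro sum.cong) simp_all
    moreover have "0 < w \<bullet> w" using g(1) by (auto simp: w_def vec_eq_iff)
    ultimately show ?thesis using ray[OF wV] by simp
  qed
  ultimately have "lambda_min S G = m"
    unfolding lambda_min_def by (intro Least_equality)
  moreover have "v \<in> V" using v by (simp add: V_def)
  ultimately show ?thesis using ray by simp
qed

section \<open>Objective, feasibility of the planted solution and duality\<close>

definition tail :: "real^('d::finite) option \<Rightarrow> real^'d" where
  "tail z = (\<chi> i. z $ Some i)"

lemma tail_nth [simp]: "tail z $ i = z $ Some i"
  by (simp add: tail_def)

lemma sum_option: "(\<Sum>j\<in>(UNIV :: 'd::finite option set). f j) = f None + (\<Sum>i\<in>UNIV. f (Some i))"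
  by (simp add: UNIV_option_conv sum.reindex)

lemma trace_gram:
  assumes "\<And>i j. W $ i $ j = (\<Sum>k\<in>K. z k $ i * z k $ j :: real)"
  shows "trace (transpose A ** A ** W) = (\<Sum>k\<in>K. (A *v z k) \<bullet> (A *v z k))"
proof -
  let ?B = "transpose A ** A"
  have "trace (?B ** W) = (\<Sum>i\<in>UNIV. \<Sum>j\<in>UNIV. \<Sum>k\<in>K. ?B $ i $ j * z k $ i * z k $ j)"
    by (simp add: trace_def matrix_matrix_mult_def[of ?B W] assms sum_distrib_left algebra_simps)
  also have "\<dots> = (\<Sum>i\<in>UNIV. \<Sum>k\<in>K. \<Sum>j\<in>UNIV. ?B $ i $ j * z k $ i * z k $ j)"
    by (intro sum.cong refl sum.swap)
  also have "\<dots> = (\<Sum>k\<in>K. z k \<bullet> (?B *v z k))"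
    unfolding inner_matrix_vector by (rule sum.swap)
  also have "\<dots> = (\<Sum>k\<in>K. (A *v z k) \<bullet> (A *v z k))"
    by (simp add: matrix_vector_mul_assoc[symmetric] dot_lmul_matrix[symmetric]
        vector_transpose_matrix inner_commute)
  finally show ?thesis .
qed

lemma data_matrix_mult: "data_matrix M b *v z = M *v tail z - z $ None *\<^sub>R b"
  by (simp add: data_matrix_def matrix_vector_mult_def vec_eq_iff sum_option)

text \<open>The objective is linear in \<open>W\<close>, so it splits over Gram vectors into
  least-squares values. \<open>K\<close> is left free: a singleton treats a rank-one matrix,
  \<open>UNIV\<close> a general feasible one.\<close>

lemma sdp_objective_gram:
  fixes M :: "real^'d^'n"
  assumes "\<And>i j. W $ i $ j = (\<Sum>k\<in>K. z k $ i * z k $ j)"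
  shows "sdp_objective M b W = (\<Sum>k\<in>K. (1 / real CARD('n)) *
    ((M *v tail (z k) - z k $ None *\<^sub>R b) \<bullet> (M *v tail (z k) - z k $ None *\<^sub>R b)))"
  unfolding sdp_objective_def trace_gram[OF assms] data_matrix_mult
  by (simp only: sum_distrib_left)

lemma pos_semidef_outer: "pos_semidef (outer v v)"
proof -
  have "transpose (outer v v) = outer v v"
    by (simp add: transpose_def outer_def vec_eq_iff mult.commute)
  then show ?thesis
    by (simp add: pos_semidef_def outer_mult_vector inner_commute)
qed

lemma sum_abs_eq_card_supp:
  assumes "\<forall>i. x $ i \<in> {-1, 0, 1 :: real}"
  shows "(\<Sum>i\<in>UNIV. \<bar>x $ i\<bar>) = real (card (supp x))"
proof -
  have "(\<Sum>i\<in>UNIV. \<bar>x $ i\<bar>) = (\<Sum>i\<in>UNIV. if i \<in> supp x then 1 else 0)"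
    using assms by (intro sum.cong) (force simp: supp_def)+
  then show ?thesis by (simp add: sum.If_cases)
qed

lemma inner_self_eq_card_supp:
  assumes "\<forall>i. x $ i \<in> {-1, 0, 1 :: real}"
  shows "x \<bullet> x = real (card (supp x))"
proof -
  have "x $ i * x $ i = \<bar>x $ i\<bar>" for i
    using assms[rule_format, of i] by auto
  then show ?thesis
    unfolding sum_abs_eq_card_supp[OF assms, symmetric] by (simp add: inner_vec_def)
qed

text \<open>The entrywise \<open>l\<^sub>1\<close> norm of \<open>x x\<^sup>T\<close> is the square
  of the \<open>l\<^sub>1\<close> norm of \<open>x\<close>, and both this norm and
  \<open>x \<bullet> x\<close> count the support. Hence the trace and \<open>l\<^sub>1\<close>
  constraints hold with equality.\<close>

lemma sdp_feasible_outer: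
  assumes x: "\<forall>i. x $ i \<in> {-1, 0, 1 :: real}"
  shows "sdp_feasible (card (supp x)) (outer (prepend_one x) (prepend_one x))"
proof -
  have "(\<Sum>i\<in>UNIV. \<Sum>j\<in>UNIV. \<bar>x $ i * x $ j\<bar>) = (\<Sum>i\<in>UNIV. \<bar>x $ i\<bar>) * (\<Sum>j\<in>UNIV. \<bar>x $ j\<bar>)"
    by (simp add: sum_product abs_mult)
  moreover have "x $ i * x $ i \<le> 1" for i
    using x[rule_format, of i] by auto
  ultimately show ?thesis
    using inner_self_eq_card_supp[OF x]
    unfolding sdp_feasible_def sum_abs_eq_card_supp[OF x]
    by (intro conjI pos_semidef_outer)
      (auto simp: delete_first_def outer_def prepend_one_def trace_def
        inner_vec_def power2_eq_square)
qed

text \<open>Weak duality. The hypothesis \<open>lagr\<close> is the Lagrangian with multipliers \<open>\<kappa>, \<mu>2, p, E\<close>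
  evaluated at a rank-one matrix; a Gram decomposition of a feasible matrix extends it to the whole
  feasible set.\<close>

lemma sdp_recovers_certificate:
  fixes M :: "real^'d^'n" and b :: "real^'n" and x p :: "real^'d" and E :: "real^'d^'d"
    and R :: "real \<Rightarrow> real^'d \<Rightarrow> real"
  defines "q \<equiv> \<lambda>t u. (1 / real CARD('n)) * ((M *v u - t *\<^sub>R b) \<bullet> (M *v u - t *\<^sub>R b))"
  assumes x: "\<forall>i. x $ i \<in> {-1, 0, 1}"
    and p: "\<And>i. 0 \<le> p $ i"
    and E: "\<And>i j. \<bar>E $ i $ j\<bar> \<le> \<mu>3"
    and E_strict: "\<And>i. i \<notin> supp x \<Longrightarrow> \<bar>E $ i $ i\<bar> < \<mu>3"
    and lagr: "\<And>t u. R t u \<le> q t u + \<kappa> * t\<^sup>2 + \<mu>2 * (u \<bullet> u)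
                 + (\<Sum>i\<in>UNIV. p $ i * (u $ i)\<^sup>2) + u \<bullet> (E *v u)"
    and R_nonneg: "\<And>t u. 0 \<le> R t u"
    and R_zero: "\<And>t u. R t u \<le> 0 \<Longrightarrow> (\<And>i. i \<notin> supp x \<Longrightarrow> u $ i = 0) \<Longrightarrow> u = t *\<^sub>R x"
    and dual_value: "q 1 x + \<kappa> + \<mu>2 * real (card (supp x)) + (\<Sum>i\<in>UNIV. p $ i)
                 + \<mu>3 * (real (card (supp x)))\<^sup>2 = 0"
  shows "sdp_recovers M b (card (supp x)) x"
proof -
  let ?\<sigma> = "real (card (supp x))"
  let ?X = "outer (prepend_one x) (prepend_one x)"
  have "tail (prepend_one x) = x" "prepend_one x $ None = 1"
    by (simp_all add: tail_def prepend_one_def vec_eq_iff)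
  then have obj_X: "sdp_objective M b ?X = q 1 x"
    by (subst sdp_objective_gram[where K = "{()}" and z = "\<lambda>_. prepend_one x"])
      (simp_all add: outer_def q_def)
  have \<mu>3: "0 \<le> \<mu>3" using E[of undefined undefined] by linarith
  have main: "q 1 x \<le> sdp_objective M b W \<and> (sdp_objective M b W \<le> q 1 x \<longrightarrow> W = ?X)"
    if feas: "sdp_feasible (card (supp x)) W" for W
  proof -
    obtain z :: "'d option \<Rightarrow> real^'d option"
      where z: "\<And>i j. W $ i $ j = (\<Sum>k\<in>UNIV. z k $ i * z k $ j)"
      using feas pos_semidef_gram[of W] unfolding sdp_feasible_def by blast
    let ?w = "\<lambda>i j. W $ Some i $ Some j"
    have W1: "W $ None $ None = 1" and tr: "(\<Sum>i\<in>UNIV. ?w i i) = ?\<sigma>"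
      and abs: "(\<Sum>i\<in>UNIV. \<Sum>j\<in>UNIV. \<bar>?w i j\<bar>) \<le> ?\<sigma>\<^sup>2" and diag: "\<And>i. ?w i i \<le> 1"
      using feas by (simp_all add: sdp_feasible_def delete_first_def trace_def)
    \<comment> \<open>Summing \<open>lagr\<close> over the Gram vectors turns each quadratic term
      into a linear function of \<open>W\<close>, to which the constraints apply.\<close>
    let ?R = "\<Sum>k\<in>UNIV. R (z k $ None) (tail (z k))"
    have "?R \<le> (\<Sum>k\<in>UNIV. q (z k $ None) (tail (z k)) + \<kappa> * (z k $ None)\<^sup>2
        + \<mu>2 * (tail (z k) \<bullet> tail (z k)) + (\<Sum>i\<in>UNIV. p $ i * (tail (z k) $ i)\<^sup>2)
        + tail (z k) \<bullet> (E *v tail (z k)))"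
      by (intro sum_mono lagr)
    also have "\<dots> = sdp_objective M b W + \<kappa> * (\<Sum>k\<in>UNIV. (z k $ None)\<^sup>2)
        + \<mu>2 * (\<Sum>k\<in>UNIV. tail (z k) \<bullet> tail (z k))
        + (\<Sum>k\<in>UNIV. \<Sum>i\<in>UNIV. p $ i * (tail (z k) $ i)\<^sup>2)
        + (\<Sum>k\<in>UNIV. tail (z k) \<bullet> (E *v tail (z k)))"
      by (simp add: sdp_objective_gram[OF z] q_def sum.distrib sum_distrib_left)
    also have "(\<Sum>k\<in>UNIV. (z k $ None)\<^sup>2) = 1"
      using W1 by (simp add: z power2_eq_square)
    also have "(\<Sum>k\<in>UNIV. tail (z k) \<bullet> tail (z k)) = (\<Sum>i\<in>UNIV. ?w i i)"
      unfolding inner_vec_def z by (subst sum.swap) simp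
    also note tr
    also have "(\<Sum>k\<in>UNIV. \<Sum>i\<in>UNIV. p $ i * (tail (z k) $ i)\<^sup>2) = (\<Sum>i\<in>UNIV. p $ i * ?w i i)"
      by (subst sum.swap) (simp add: z power2_eq_square sum_distrib_left)
    also have "(\<Sum>k\<in>UNIV. tail (z k) \<bullet> (E *v tail (z k)))
        = (\<Sum>i\<in>UNIV. \<Sum>k\<in>UNIV. \<Sum>j\<in>UNIV. E $ i $ j * z k $ Some i * z k $ Some j)"
      unfolding inner_matrix_vector tail_nth by (rule sum.swap)
    also have "\<dots> = (\<Sum>i\<in>UNIV. \<Sum>j\<in>UNIV. \<Sum>k\<in>UNIV. E $ i $ j * z k $ Some i * z k $ Some j)"
      by (intro sum.cong refl sum.swap)
    also have "\<dots> = (\<Sum>i\<in>UNIV. \<Sum>j\<in>UNIV. E $ i $ j * ?w i j)"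
      by (simp add: z sum_distrib_left algebra_simps)
    finally have R_le: "?R \<le> sdp_objective M b W + \<kappa> + \<mu>2 * ?\<sigma> + (\<Sum>i\<in>UNIV. p $ i * ?w i i)
        + (\<Sum>i\<in>UNIV. \<Sum>j\<in>UNIV. E $ i $ j * ?w i j)" by simp
    have p_le: "(\<Sum>i\<in>UNIV. p $ i * ?w i i) \<le> (\<Sum>i\<in>UNIV. p $ i)"
      using p diag by (intro sum_mono) (simp add: mult_left_le)
    have E_le: "E $ i $ j * ?w i j \<le> \<bar>E $ i $ j\<bar> * \<bar>?w i j\<bar>" for i j
      using abs_ge_self[of "E $ i $ j * ?w i j"] by (simp only: abs_mult)
    also have "\<bar>E $ i $ j\<bar> * \<bar>?w i j\<bar> \<le> \<mu>3 * \<bar>?w i j\<bar>" for i j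
      using E by (simp add: mult_right_mono)
    finally have slack: "0 \<le> \<mu>3 * \<bar>?w i j\<bar> - E $ i $ j * ?w i j" for i j by simp
    \<comment> \<open>\<open>?D\<close> is the total entrywise gap in bounding the pairing of
      \<open>E\<close> with \<open>W\<close> by \<open>\<mu>3\<close> times the
      \<open>l\<^sub>1\<close> norm. Together with \<open>?R\<close> it is bounded by the excess of
      the objective over \<open>q 1 x\<close>.\<close>
    let ?D = "\<Sum>i\<in>UNIV. \<Sum>j\<in>UNIV. \<mu>3 * \<bar>?w i j\<bar> - E $ i $ j * ?w i j"
    have D: "?D + (\<Sum>i\<in>UNIV. \<Sum>j\<in>UNIV. E $ i $ j * ?w i j) \<le> \<mu>3 * ?\<sigma>\<^sup>2"
      using mult_left_mono[OF abs \<mu>3] by (simp add: sum_subtractf sum_distrib_left)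
    have total: "?R + ?D \<le> sdp_objective M b W - q 1 x"
      using R_le D p_le dual_value by linarith
    have D0: "0 \<le> ?D" and R0: "0 \<le> ?R"
      using slack R_nonneg by (auto intro!: sum_nonneg)
    have "W = ?X" if "sdp_objective M b W \<le> q 1 x"
    proof -
      \<comment> \<open>Complementary slackness: at the optimal value both nonnegative gaps vanish,
        hence so do all their summands. Off the support \<open>E_strict\<close> then forces zero
        diagonal entries of \<open>W\<close>; these are sums of squares, so the Gram vectors vanish
        there, which is what \<open>R_zero\<close> requires.\<close>
      have "?D = 0" "?R = 0" using total D0 R0 that by linarith+
      have "\<mu>3 * \<bar>?w i j\<bar> - E $ i $ j * ?w i j = 0" for i j
      proof -
        have "\<forall>i\<in>UNIV. (\<Sum>j\<in>UNIV. \<mu>3 * \<bar>?w i j\<bar> - E $ i $ j * ?w i j) = 0"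
          using \<open>?D = 0\<close> slack by (subst (asm) sum_nonneg_eq_0_iff) (auto intro!: sum_nonneg)
        then have "(\<Sum>j\<in>UNIV. \<mu>3 * \<bar>?w i j\<bar> - E $ i $ j * ?w i j) = 0" by simp
        then show ?thesis
          using slack by (subst (asm) sum_nonneg_eq_0_iff) auto
      qed
      then have "\<mu>3 * \<bar>?w i j\<bar> \<le> \<bar>E $ i $ j\<bar> * \<bar>?w i j\<bar>" for i j
        using E_le[of i j] by (simp only: right_minus_eq)
      then have "?w i i = 0" if "i \<notin> supp x" for i
        using E_strict[OF that] by (metis mult_le_cancel_right not_le zero_less_abs_iff)
      then have off: "tail (z k) $ i = 0" if "i \<notin> supp x" for i k
        using that z[of "Some i" "Some i"] by (simp add: sum_nonneg_eq_0_iff)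
      have "R (z k $ None) (tail (z k)) = 0" for k
        using \<open>?R = 0\<close> R_nonneg by (subst (asm) sum_nonneg_eq_0_iff) auto
      then have tl: "tail (z k) = z k $ None *\<^sub>R x" for k
        using R_zero off by simp
      have zz: "z k $ i = z k $ None * prepend_one x $ i" for k i
      proof (cases i)
        case None then show ?thesis by (simp add: prepend_one_def)
      next
        case (Some j)
        then show ?thesis
          using arg_cong[OF tl[of k], of "\<lambda>v. v $ j"] by (simp add: prepend_one_def)
      qed
      have "W $ i $ j
          = (\<Sum>k\<in>UNIV. (z k $ None * prepend_one x $ i) * (z k $ None * prepend_one x $ j))" for i j
        unfolding z by (intro sum.cong refl arg_cong2[of _ _ _ _ times] zz)
      also have "(\<Sum>k\<in>UNIV. (z k $ None * prepend_one x $ i) * (z k $ None * prepend_one x $ j))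
          = W $ None $ None * (prepend_one x $ i * prepend_one x $ j)" for i j
        unfolding z sum_distrib_right by (intro sum.cong) simp_all
      finally show ?thesis
        by (simp add: W1 outer_def vec_eq_iff)
    qed
    then show ?thesis using total D0 R0 by auto
  qed
  have feas_X: "sdp_feasible (card (supp x)) ?X" using x by (rule sdp_feasible_outer)
  have "sdp_optimal M b (card (supp x)) W \<longleftrightarrow> W = ?X" for W
  proof
    assume "sdp_optimal M b (card (supp x)) W"
    then have "sdp_feasible (card (supp x)) W" "sdp_objective M b W \<le> q 1 x"
      using feas_X unfolding sdp_optimal_def obj_X[symmetric] by auto
    then show "W = ?X" using main[of W] by simp
  next
    assume "W = ?X"
    then show "sdp_optimal M b (card (supp x)) W"
      using feas_X main unfolding sdp_optimal_def obj_X[symmetric] by auto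
  qed
  then show ?thesis using x by (simp add: sdp_recovers_def singleton_conv)
qed

text \<open>The Schur complement argument without inverses: subtracting \<open>(t + s / Y) *\<^sub>R x\<close> from \<open>u\<close>
  removes the null vector \<open>(1, x)\<close> and completes the square along \<open>x\<close>; what remains couples \<open>s\<close>
  only to \<open>r\<close>, the correction of \<open>x\<close> by a multiple of \<open>B *v x = - y\<close> that is orthogonal to \<open>x\<close>.\<close>

lemma schur_complement_identity:
  fixes B :: "real^'a^'a" and x y u r :: "real^'a" and s t Y \<sigma> \<delta> :: real
  assumes sym: "transpose B = B" and Bx: "B *v x = - y"
    and Y: "Y = - (y \<bullet> x)" "Y \<noteq> 0" and \<sigma>: "\<sigma> = x \<bullet> x" "\<sigma> \<noteq> 0" and \<delta>: "\<delta> \<noteq> 0"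
    and r: "r = x + (\<sigma> / Y) *\<^sub>R y" and u': "u' = u - (t + s / Y) *\<^sub>R x"
  shows "Y * t\<^sup>2 + 2 * t * (y \<bullet> u + s) + u \<bullet> (B *v u) - (2 / \<sigma>) * s * (x \<bullet> u)
           + (1 / Y + (r \<bullet> r) / (\<sigma>\<^sup>2 * \<delta>)) * s\<^sup>2
         = u' \<bullet> (B *v u') - \<delta> * (u' \<bullet> u')
           + \<delta> * ((u' - (s / (\<sigma> * \<delta>)) *\<^sub>R r) \<bullet> (u' - (s / (\<sigma> * \<delta>)) *\<^sub>R r))"
proof -
  define a where "a = t + s / Y"
  have u: "u = u' + a *\<^sub>R x" by (simp add: u' a_def)
  have xy: "x \<bullet> y = - Y" using Y by (simp add: inner_commute)
  have xr: "x \<bullet> r = 0"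
    using Y(2) by (simp add: r inner_add_right xy \<sigma>(1)[symmetric])
  have xBu: "x \<bullet> (B *v u') = - (y \<bullet> u')"
    using inner_matrix_symmetric[OF sym, of x u'] Bx by (simp add: inner_commute)
  \<comment> \<open>Trading \<open>x\<close> for \<open>r\<close> and \<open>y\<close> gives every
    \<open>y \<bullet> u'\<close> in the left-hand side the common factor
    \<open>t - a + s / Y\<close>, which is 0. The terms in \<open>t\<close> and \<open>s\<close>
    without \<open>u'\<close> cancel for the same \<open>a\<close>, except the one with
    \<open>r \<bullet> r\<close>, which completes the square in \<open>sq\<close>.\<close>
  have xu: "x \<bullet> u' = r \<bullet> u' - (\<sigma> / Y) * (y \<bullet> u')"
    by (simp add: r inner_add_left)
  have yx: "y \<bullet> x = - Y" using Y by simp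
  have uBu: "u \<bullet> (B *v u) = u' \<bullet> (B *v u') - 2 * a * (y \<bullet> u') + a\<^sup>2 * Y"
    unfolding u
    by (simp add: matrix_vector_right_distrib matrix_vector_mult_scaleR inner_add_left
        inner_add_right Bx xBu inner_commute[of _ y] yx power2_eq_square algebra_simps)
  have yu: "y \<bullet> u = y \<bullet> u' - a * Y" unfolding u by (simp add: inner_add_right yx)
  have xu2: "x \<bullet> u = r \<bullet> u' - (\<sigma> / Y) * (y \<bullet> u') + a * \<sigma>"
    unfolding u by (simp add: inner_add_right xu \<sigma>(1))
  have sq: "\<delta> * ((u' - (s / (\<sigma> * \<delta>)) *\<^sub>R r) \<bullet> (u' - (s / (\<sigma> * \<delta>)) *\<^sub>R r))
      = \<delta> * (u' \<bullet> u') - (2 / \<sigma>) * s * (r \<bullet> u') + (r \<bullet> r) / (\<sigma>\<^sup>2 * \<delta>) * s\<^sup>2"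
    using \<sigma>(2) \<delta>
    by (simp add: inner_diff_left inner_diff_right inner_commute[of u' r] power2_eq_square
        field_simps)
  show ?thesis
    unfolding sq uBu yu xu2 a_def using \<sigma>(2) \<delta> Y(2)
    by (simp add: power2_eq_square field_simps)
qed

section \<open>Construction and verification of the dual certificate\<close>

lemma inf_norm_mat_ge: "i \<in> I \<Longrightarrow> j \<in> J \<Longrightarrow> \<bar>N $ i $ j\<bar> \<le> inf_norm_mat I J N"
  unfolding inf_norm_mat_def by (intro Max_ge) (auto intro!: rev_image_eqI[of "(i, j)"])

lemma inf_norm_vec_ge: "i \<in> I \<Longrightarrow> \<bar>v $ i\<bar> \<le> inf_norm_vec I v"
  unfolding inf_norm_vec_def by (intro Max_ge) auto

lemma inf_norm_mat_nonneg: "0 \<le> inf_norm_mat I J N"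
  unfolding inf_norm_mat_def by (intro Max_ge) auto

lemma outer_nth: "outer u v $ i $ j = u $ i * v $ j"
  by (simp add: outer_def)

lemma mat_nth: "mat c $ i $ j = (if i = j then c else 0)"
  by (simp add: mat_def)

theorem theorem4:
  fixes M :: "real^'d^'n" and b :: "real^'n" and \<sigma> :: nat
    and x y :: "real^'d" and G :: "real^'d^'d" and S :: "'d set" and Y11 \<theta> :: real
    and \<mu>3 :: "real \<Rightarrow> real"
  assumes sigma_pos: "0 < \<sigma>" and sigma_le: "\<sigma> \<le> CARD('d)"
    and x_vals: "\<forall>i. x $ i \<in> {-1, 0, 1}"
    and S_eq: "S = supp x"
    and card_S: "card S = \<sigma>"
    and G_eq: "G = (1 / real CARD('n)) *\<^sub>R (transpose M ** M)"
    and y_eq: "y = - ((1 / real CARD('n)) *\<^sub>R (transpose M *v b))"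
    and Y11_eq: "Y11 = - (\<Sum>i\<in>S. y $ i * x $ i)"
    and Y11_pos: "Y11 > 0"
    and theta_eq: "\<theta> = arccos ((\<Sum>i\<in>S. y $ i * x $ i) / (sqrt (real \<sigma>) * L2_set (\<lambda>i. y $ i) S))"
    and mu3_eq: "\<And>\<delta>. \<mu>3 \<delta> = (1 / real \<sigma>) *
          (lambda_min S G - \<delta> + Min ((\<lambda>i. (- y $ i - (\<Sum>j\<in>S. G $ i $ j * x $ j)) / x $ i) ` S))"
    and conditions: "\<exists>\<delta>>0.
          inf_norm_mat (- S) S (G + (1 / real \<sigma>) *\<^sub>R outer y x) \<le> \<mu>3 \<delta> \<and>
          (\<exists>\<mu>2 \<le> - lambda_min S G + \<delta>.
             inf_norm_mat (- S) (- S) (G + mat \<mu>2)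
             + inf_norm_mat (- S) (- S) ((1 / Y11) *\<^sub>R outer y y)
             + (1 - (cos \<theta>)\<^sup>2) / (real \<sigma> * \<delta> * (cos \<theta>)\<^sup>2) * (inf_norm_vec (- S) y)\<^sup>2
             < \<mu>3 \<delta>)"
  shows "sdp_recovers M b \<sigma> x"
proof -
  obtain \<delta> \<mu>2 where \<delta>: "0 < \<delta>"
    and B1: "inf_norm_mat (- S) S (G + (1 / real \<sigma>) *\<^sub>R outer y x) \<le> \<mu>3 \<delta>"
    and \<mu>2: "\<mu>2 \<le> - lambda_min S G + \<delta>"
    and B2: "inf_norm_mat (- S) (- S) (G + mat \<mu>2)
             + inf_norm_mat (- S) (- S) ((1 / Y11) *\<^sub>R outer y y)
             + (1 - (cos \<theta>)\<^sup>2) / (real \<sigma> * \<delta> * (cos \<theta>)\<^sup>2) * (inf_norm_vec (- S) y)\<^sup>2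
             < \<mu>3 \<delta>"
    using conditions by blast
  define m where "m = \<mu>3 \<delta>"
  define s where "s = real \<sigma>"
  define l where "l = lambda_min S G"
  let ?n = "real CARD('n)"
  \<comment> \<open>As a multiplier of an inequality, \<open>m\<close> must be nonnegative. This
    follows from (B1), also for empty \<open>- S\<close>, since the norm is then 0.\<close>
  have m_nonneg: "0 \<le> m"
    using inf_norm_mat_nonneg B1 unfolding m_def by (rule order_trans)
  have s: "0 < s" using sigma_pos by (simp add: s_def)
  have S: "S \<noteq> {}" using card_S sigma_pos by auto
  have x_off: "x $ i = 0" if "i \<notin> S" for i using that by (simp add: S_eq supp_def)
  have x_on: "x $ i * x $ i = 1" "x $ i \<noteq> 0" if "i \<in> S" for i
    using that x_vals[rule_format, of i] by (auto simp: S_eq supp_def)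
  have xx: "x \<bullet> x = s"
    using inner_self_eq_card_supp[OF x_vals] card_S by (simp add: s_def S_eq)
  have symG: "transpose G = G"
    by (simp add: G_eq transpose_scalar matrix_transpose_mul)
  then have symG': "G $ i $ j = G $ j $ i" for i j
    by (metis transpose_def vec_lambda_beta)

  \<comment> \<open>Blocks are handled as vectors and matrices of full size, extended by zero:
    \<open>yS\<close> and \<open>yT\<close> are the parts of \<open>y\<close> on \<open>S\<close>
    and on its complement.\<close>
  define restr where "restr u = (\<chi> i. if i \<in> S then u $ i else 0)" for u :: "real^'d"
  have restr_nth: "restr u $ i = (if i \<in> S then u $ i else 0)" for u i
    by (simp add: restr_def)
  define yS where "yS = restr y"
  define yT where "yT = y - yS"
  have yT_nth: "yT $ i = (if i \<in> S then 0 else y $ i)" for i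
    by (simp add: yT_def yS_def restr_nth)
  have x_inner: "x \<bullet> u = x \<bullet> restr u" for u
    unfolding inner_vec_def by (intro sum.cong) (auto simp: restr_nth x_off)
  have yS_inner: "yS \<bullet> u = yS \<bullet> restr u" for u
    unfolding inner_vec_def by (intro sum.cong) (auto simp: restr_nth yS_def)
  have yTx: "yT \<bullet> x = 0"
    unfolding inner_vec_def by (intro sum.neutral) (auto simp: yT_nth x_off)
  have sumS: "(\<Sum>i\<in>S. y $ i * x $ i) = yS \<bullet> x"
    unfolding inner_vec_def
    by (subst sum_eq_sum_restrict[where S = S]) (auto simp: yS_def restr_nth)
  have Y: "Y11 = - (yS \<bullet> x)" using Y11_eq sumS by simp

  \<comment> \<open>\<open>B\<close> is the \<open>S \<times> S\<close> block of the Lagrangian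
    matrix. Its diagonal correction \<open>q\<close> solves \<open>B *v x = - yS\<close>, which is
    stationarity at \<open>x\<close>; here \<open>x \<bullet> x = s\<close> produces the term
    \<open>m * s\<close>.\<close>
  define q where "q i = (- y $ i - (\<Sum>j\<in>S. G $ i $ j * x $ j)) / x $ i - m * s" for i
  define B where "B = (\<chi> i j. if i \<in> S \<and> j \<in> S
      then G $ i $ j + m * x $ i * x $ j + (if i = j then q i else 0) else 0)"
  have B_nth: "B $ i $ j = (if i \<in> S \<and> j \<in> S
      then G $ i $ j + m * x $ i * x $ j + (if i = j then q i else 0) else 0)" for i j
    by (simp add: B_def)
  have symB: "transpose B = B"
    using symG' by (auto simp: transpose_def vec_eq_iff B_nth)
  \<comment> \<open>The formula for the third multiplier is chosen so that the least
    \<open>q i\<close> over \<open>S\<close> is exactly \<open>\<delta> - l\<close>.\<close>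
  have q_ge: "\<delta> - l \<le> q i" if "i \<in> S" for i
  proof -
    have "Min ((\<lambda>i. (- y $ i - (\<Sum>j\<in>S. G $ i $ j * x $ j)) / x $ i) ` S)
        \<le> (- y $ i - (\<Sum>j\<in>S. G $ i $ j * x $ j)) / x $ i"
      using that by (intro Min_le) auto
    moreover have "m * s = l - \<delta> + Min ((\<lambda>i. (- y $ i - (\<Sum>j\<in>S. G $ i $ j * x $ j)) / x $ i) ` S)"
      using sigma_pos by (simp add: m_def s_def mu3_eq l_def)
    ultimately show ?thesis by (simp add: q_def)
  qed
  have Bv: "(B *v v) $ i = (\<Sum>j\<in>S. G $ i $ j * v $ j) + m * x $ i * (x \<bullet> v) + q i * v $ i"
    if "i \<in> S" for v i
  proof -
    have "(B *v v) $ i = (\<Sum>j\<in>S. B $ i $ j * v $ j)"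
      unfolding matrix_vector_mult_def by (simp, intro sum_eq_sum_restrict) (simp add: B_nth)
    also have "\<dots> = (\<Sum>j\<in>S. G $ i $ j * v $ j + m * x $ i * (x $ j * v $ j)
        + (if i = j then q i * v $ j else 0))"
      using that by (intro sum.cong) (auto simp: B_nth algebra_simps)
    also have "\<dots> = (\<Sum>j\<in>S. G $ i $ j * v $ j) + m * x $ i * (\<Sum>j\<in>S. x $ j * v $ j) + q i * v $ i"
      using that by (simp add: sum.distrib sum_distrib_left)
    also have "(\<Sum>j\<in>S. x $ j * v $ j) = x \<bullet> v"
      unfolding inner_vec_def by (subst sum_eq_sum_restrict[where S = S]) (auto simp: x_off)
    finally show ?thesis .
  qed
  have Bv_off: "(B *v v) $ i = 0" if "i \<notin> S" for v i
    using that by (simp add: matrix_vector_mult_def B_nth)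
  have Bx: "B *v x = - yS"
  proof -
    have "(B *v x) $ i = - yS $ i" for i
      by (cases "i \<in> S")
        (simp_all add: Bv Bv_off yS_def restr_nth xx q_def x_on field_simps)
    then show ?thesis by (simp add: vec_eq_iff)
  qed
  have B_restr: "u \<bullet> (B *v u) = restr u \<bullet> (B *v restr u)" for u
    unfolding inner_matrix_vector by (intro sum.cong refl) (simp add: B_nth restr_nth)
  \<comment> \<open>\<open>G\<close> contributes at least \<open>l\<close>, the diagonal
    \<open>q\<close> at least \<open>\<delta> - l\<close>, and the rank-one term with factor
    \<open>m\<close> is nonnegative. The margin \<delta> pays for the coupling with the complement
    of \<open>S\<close>.\<close>
  have B_ge: "\<delta> * (v \<bullet> v) \<le> v \<bullet> (B *v v)" if v: "\<And>i. i \<notin> S \<Longrightarrow> v $ i = 0" for v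
  proof -
    have *: "v $ i * (B *v v) $ i = v $ i * (G *v v) $ i + m * (x \<bullet> v) * (x $ i * v $ i)
        + q i * (v $ i * v $ i)" for i
    proof (cases "i \<in> S")
      case True
      have "(G *v v) $ i = (\<Sum>j\<in>S. G $ i $ j * v $ j)"
        unfolding matrix_vector_mult_def by (simp, intro sum_eq_sum_restrict) (simp add: v)
      then show ?thesis by (simp add: Bv[OF True] algebra_simps)
    qed (simp add: v)
    have "v \<bullet> (B *v v) = v \<bullet> (G *v v) + m * (x \<bullet> v) * (x \<bullet> v) + (\<Sum>i\<in>UNIV. q i * (v $ i * v $ i))"
      unfolding inner_vec_def inner_real_def * sum.distrib sum_distrib_left by simp
    moreover have "l * (v \<bullet> v) \<le> v \<bullet> (G *v v)"
      unfolding l_def by (rule lambda_min_rayleigh[OF symG S v])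
    moreover have "(\<delta> - l) * (v \<bullet> v) \<le> (\<Sum>i\<in>UNIV. q i * (v $ i * v $ i))"
      unfolding inner_vec_def inner_real_def sum_distrib_left
    proof (intro sum_mono)
      fix i show "(\<delta> - l) * (v $ i * v $ i) \<le> q i * (v $ i * v $ i)"
        using q_ge[of i] v[of i] by (cases "i \<in> S") (auto intro: mult_right_mono)
    qed
    moreover have "0 \<le> m * (x \<bullet> v) * (x \<bullet> v)"
      using m_nonneg by (simp add: mult.assoc)
    ultimately show ?thesis by (simp add: algebra_simps)
  qed

  define r where "r = x + (s / Y11) *\<^sub>R yS"
  define c where "c = (r \<bullet> r) / (s\<^sup>2 * \<delta>)"
  have c0: "0 \<le> c" using \<delta> by (simp add: c_def)
  \<comment> \<open>Since \<open>r\<close> is orthogonal to \<open>x\<close>, its squared norm is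
    \<sigma> times the squared tangent of \<theta>; this links the Schur complement constant to the
    angle in (B2). Cauchy-Schwarz puts the argument of \<open>arccos\<close> into [-1, 1], so
    \<open>cos\<close> inverts it.\<close>
  have c_eq: "(1 - (cos \<theta>)\<^sup>2) / (s * \<delta> * (cos \<theta>)\<^sup>2) = c"
  proof -
    define L where "L = L2_set (\<lambda>i. y $ i) S"
    have L2: "L\<^sup>2 = yS \<bullet> yS"
    proof -
      have "L\<^sup>2 = (\<Sum>i\<in>S. (y $ i)\<^sup>2)" by (simp add: L_def L2_set_def sum_nonneg)
      also have "\<dots> = yS \<bullet> yS"
        unfolding inner_vec_def
        by (subst sum_eq_sum_restrict[where S = S]) (auto simp: yS_def restr_nth power2_eq_square)
      finally show ?thesis .
    qed
    have L0: "0 \<le> L" by (simp add: L_def)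
    have "L = norm yS" using L2 L0 by (simp add: norm_eq_sqrt_inner L2[symmetric])
    moreover have "sqrt s = norm x" by (simp add: norm_eq_sqrt_inner xx)
    ultimately have "\<bar>yS \<bullet> x\<bar> \<le> sqrt s * L"
      using Cauchy_Schwarz_ineq2[of yS x] by (simp add: mult.commute)
    moreover have "yS \<bullet> x < 0" using Y Y11_pos by simp
    ultimately have L: "0 < L" using s L0
      by (metis abs_ge_zero abs_le_zero_iff less_irrefl mult_zero_right order_le_less)
    have "\<bar>(yS \<bullet> x) / (sqrt s * L)\<bar> \<le> 1"
      using \<open>\<bar>yS \<bullet> x\<bar> \<le> sqrt s * L\<close> L s by (simp add: abs_mult)
    then have "cos \<theta> = (yS \<bullet> x) / (sqrt s * L)"
      unfolding theta_eq sumS L_def[symmetric] s_def[symmetric]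
      by (intro cos_arccos) (auto simp only: abs_le_iff)
    then have cos2: "(cos \<theta>)\<^sup>2 = Y11\<^sup>2 / (s * L\<^sup>2)"
      using s by (simp add: Y power_divide power_mult_distrib)
    have "x \<bullet> yS = - Y11" "yS \<bullet> x = - Y11" using Y by (simp_all add: inner_commute)
    then have rr: "r \<bullet> r = s\<^sup>2 * L\<^sup>2 / Y11\<^sup>2 - s"
      using Y11_pos
      by (simp add: r_def inner_add_left inner_add_right xx L2[symmetric] power2_eq_square
          field_simps)
    show ?thesis
      unfolding c_def cos2 rr using s L \<delta> Y11_pos
      by (simp add: power2_eq_square field_simps)
  qed

  \<comment> \<open>On \<open>S\<close> the trace and diagonal multipliers add up to
    \<open>q\<close>; \<open>p\<close> is nonnegative because
    \<open>\<mu>2 \<le> \<delta> - l\<close>. \<open>K\<close> is the intended lower right block of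
    the Lagrangian matrix, and \<open>E\<close> is whatever then remains for the
    \<open>l\<^sub>1\<close> constraint.\<close>
  define p where "p = (\<chi> i. if i \<in> S then q i - \<mu>2 else 0)"
  define P where "P = (\<chi> i j. if i = j then p $ i else 0)"
  define K where "K = B - (1 / s) *\<^sub>R (outer yT x + outer x yT) + (1 / Y11 + c) *\<^sub>R outer yT yT"
  define E where "E = K - G - mat \<mu>2 - P"
  have E_nth: "E $ i $ j = B $ i $ j - (yT $ i * x $ j + x $ i * yT $ j) / s
      + (1 / Y11 + c) * (yT $ i * yT $ j) - G $ i $ j
      - (if i = j then \<mu>2 + p $ i else 0)" for i j
    by (simp add: E_def K_def P_def outer_nth mat_nth)
  have p0: "0 \<le> p $ i" for i
    using q_ge[of i] \<mu>2 by (auto simp: p_def l_def)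
  have E_SS: "E $ i $ j = m * (x $ i * x $ j)" if "i \<in> S" "j \<in> S" for i j
    using that by (simp add: E_nth B_nth yT_nth p_def)
  \<comment> \<open>On the mixed blocks \<open>E\<close> is, up to sign and transposition, the
    matrix bounded in (B1).\<close>
  have E_TS: "\<bar>E $ i $ j\<bar> \<le> m" "\<bar>E $ j $ i\<bar> \<le> m" if "i \<notin> S" "j \<in> S" for i j
  proof -
    have "\<bar>(G + (1 / real \<sigma>) *\<^sub>R outer y x) $ i $ j\<bar> \<le> m"
      using inf_norm_mat_ge[of i "- S" j S] B1 that unfolding m_def by (meson ComplI order_trans)
    then have "\<bar>G $ i $ j + y $ i * x $ j / s\<bar> \<le> m" by (simp add: outer_nth s_def)
    moreover have "E $ i $ j = - (G $ i $ j + y $ i * x $ j / s)"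
      "E $ j $ i = - (G $ i $ j + y $ i * x $ j / s)"
      using that x_off by (auto simp: E_nth B_nth yT_nth symG'[of j i])
    ultimately show "\<bar>E $ i $ j\<bar> \<le> m" "\<bar>E $ j $ i\<bar> \<le> m" by simp_all
  qed
  \<comment> \<open>The three summands of \<open>E\<close> on this block match the three summands of
    (B2).\<close>
  have E_TT: "\<bar>E $ i $ j\<bar> < m" if "i \<notin> S" "j \<notin> S" for i j
  proof -
    have "E $ i $ j = - (G + mat \<mu>2) $ i $ j + ((1 / Y11) *\<^sub>R outer y y) $ i $ j
        + c * (y $ i * y $ j)"
      using that by (auto simp: E_nth B_nth yT_nth p_def outer_nth mat_nth x_off algebra_simps)
    then have "\<bar>E $ i $ j\<bar> \<le> \<bar>(G + mat \<mu>2) $ i $ j\<bar> + \<bar>((1 / Y11) *\<^sub>R outer y y) $ i $ j\<bar>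
        + \<bar>c * (y $ i * y $ j)\<bar>" by linarith
    moreover have "\<bar>c * (y $ i * y $ j)\<bar> \<le> c * (inf_norm_vec (- S) y)\<^sup>2"
    proof -
      have "\<bar>y $ i\<bar> * \<bar>y $ j\<bar> \<le> inf_norm_vec (- S) y * inf_norm_vec (- S) y"
        using inf_norm_vec_ge[of i "- S" y] inf_norm_vec_ge[of j "- S" y] that
        by (intro mult_mono) (auto intro: order_trans[OF abs_ge_zero])
      then show ?thesis
        using c0 by (simp add: abs_mult power2_eq_square mult_left_mono)
    qed
    moreover have "\<bar>(G + mat \<mu>2) $ i $ j\<bar> \<le> inf_norm_mat (- S) (- S) (G + mat \<mu>2)"
      "\<bar>((1 / Y11) *\<^sub>R outer y y) $ i $ j\<bar> \<le> inf_norm_mat (- S) (- S) ((1 / Y11) *\<^sub>R outer y y)"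
      using that by (intro inf_norm_mat_ge; simp)+
    ultimately show ?thesis
      using B2 unfolding s_def[symmetric] c_eq m_def[symmetric] by linarith
  qed
  have E_le: "\<bar>E $ i $ j\<bar> \<le> m" for i j
  proof -
    have "\<bar>x $ i\<bar> = 1" if "i \<in> S" for i
      using that x_vals[rule_format, of i] x_on(2) by auto
    then have "\<bar>E $ i $ j\<bar> = m" if "i \<in> S" "j \<in> S"
      using that m_nonneg by (simp add: E_SS abs_mult)
    then show ?thesis
      using E_TS E_TT by (cases "i \<in> S"; cases "j \<in> S") (auto simp: less_imp_le)
  qed

  let ?q = "\<lambda>t u. (1 / ?n) * ((M *v u - t *\<^sub>R b) \<bullet> (M *v u - t *\<^sub>R b))"
  \<comment> \<open>The multiplier of the constraint on the first diagonal entry replaces the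
    coefficient \<open>(b \<bullet> b) / ?n\<close> of \<open>t\<^sup>2\<close> by
    \<open>Y11\<close>, which makes \<open>(1, x)\<close> a null vector of the Lagrangian
    form.\<close>
  define \<kappa> where "\<kappa> = Y11 - (b \<bullet> b) / ?n"
  have q_eq: "?q t u = u \<bullet> (G *v u) + 2 * t * (y \<bullet> u) + t\<^sup>2 * ((b \<bullet> b) / ?n)" for t u
  proof -
    have uGu: "u \<bullet> (G *v u) = (1 / ?n) * ((M *v u) \<bullet> (M *v u))"
      by (simp add: G_eq scaleR_matrix_vector_assoc[symmetric] matrix_vector_mul_assoc[symmetric]
          dot_lmul_matrix[symmetric] vector_transpose_matrix inner_commute)
    have yu: "y \<bullet> u = - (1 / ?n) * (b \<bullet> (M *v u))"
      by (simp add: y_eq dot_lmul_matrix[symmetric] transpose_matrix_vector)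
    show ?thesis
      by (simp add: uGu yu inner_diff_left inner_diff_right inner_commute[of "M *v u" b] power2_eq_square
          field_simps)
  qed
  have L_eq: "?q t u + \<kappa> * t\<^sup>2 + \<mu>2 * (u \<bullet> u) + (\<Sum>i\<in>UNIV. p $ i * (u $ i)\<^sup>2) + u \<bullet> (E *v u)
      = Y11 * t\<^sup>2 + 2 * t * (yS \<bullet> u + yT \<bullet> u) + u \<bullet> (B *v u) - (2 / s) * (yT \<bullet> u) * (x \<bullet> u)
        + (1 / Y11 + c) * (yT \<bullet> u)\<^sup>2" for t u
  proof -
    have "P *v u = (\<chi> i. p $ i * u $ i)"
      by (simp add: P_def matrix_vector_mult_def vec_eq_iff if_distrib[of "\<lambda>a. a * _"] cong: if_cong)
    then have "u \<bullet> (P *v u) = (\<Sum>i\<in>UNIV. p $ i * (u $ i)\<^sup>2)"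
      by (simp add: inner_vec_def power2_eq_square algebra_simps)
    moreover have "mat \<mu>2 *v u = \<mu>2 *\<^sub>R u"
      by (simp add: mat_def matrix_vector_mult_def vec_eq_iff if_distrib[of "\<lambda>a. a * _"] cong: if_cong)
    moreover have "u \<bullet> (K *v u) = u \<bullet> (B *v u) - (2 / s) * (yT \<bullet> u) * (x \<bullet> u)
        + (1 / Y11 + c) * (yT \<bullet> u)\<^sup>2"
      by (simp add: K_def matrix_vector_mult_add_rdistrib matrix_vector_mult_diff_rdistrib
          scaleR_matrix_vector_assoc[symmetric] outer_mult_vector inner_add_right inner_diff_right
          inner_commute[of u] power2_eq_square)
    moreover have "y \<bullet> u = yS \<bullet> u + yT \<bullet> u" by (simp add: yT_def inner_diff_left)
    ultimately show ?thesis
      unfolding q_eq E_def \<kappa>_def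
      by (simp add: matrix_vector_mult_diff_rdistrib inner_diff_right algebra_simps)
  qed

  \<comment> \<open>\<open>h\<close> is the shifted vector and \<open>R\<close> the leftover square
    of the Schur complement identity, taken with \<open>yS\<close> for \<open>y\<close>,
    \<open>restr u\<close> for \<open>u\<close> and \<open>yT \<bullet> u\<close> for
    \<open>s\<close>. By \<open>B_ge\<close> the rest of the right-hand side is nonnegative.\<close>
  define h where "h t u = restr u - (t + (yT \<bullet> u) / Y11) *\<^sub>R x" for t u
  define R where "R t u = \<delta> * ((h t u - ((yT \<bullet> u) / (s * \<delta>)) *\<^sub>R r)
      \<bullet> (h t u - ((yT \<bullet> u) / (s * \<delta>)) *\<^sub>R r))" for t u
  have "sdp_recovers M b (card (supp x)) x"
  proof (rule sdp_recovers_certificate[where p = p and E = E and R = R and \<kappa> = \<kappa>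
        and ?\<mu>2.0 = \<mu>2 and ?\<mu>3.0 = m])
    fix t u
    have "h t u $ i = 0" if "i \<notin> S" for i
      using that by (simp add: h_def restr_nth x_off)
    then have "\<delta> * (h t u \<bullet> h t u) \<le> h t u \<bullet> (B *v h t u)" by (rule B_ge)
    moreover have "Y11 * t\<^sup>2 + 2 * t * (yS \<bullet> restr u + yT \<bullet> u) + restr u \<bullet> (B *v restr u)
        - (2 / s) * (yT \<bullet> u) * (x \<bullet> restr u) + (1 / Y11 + c) * (yT \<bullet> u)\<^sup>2
        = h t u \<bullet> (B *v h t u) - \<delta> * (h t u \<bullet> h t u) + R t u"
      unfolding R_def c_def
      by (rule schur_complement_identity[OF symB Bx Y])
        (use Y11_pos s \<delta> xx in \<open>auto simp: r_def h_def\<close>)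
    ultimately show "R t u \<le> ?q t u + \<kappa> * t\<^sup>2 + \<mu>2 * (u \<bullet> u)
        + (\<Sum>i\<in>UNIV. p $ i * (u $ i)\<^sup>2) + u \<bullet> (E *v u)"
      unfolding L_eq B_restr[of u] x_inner[of u] yS_inner[of u] by linarith
  next
    fix t u assume "R t u \<le> 0" and off: "\<And>i. i \<notin> supp x \<Longrightarrow> u $ i = 0"
    \<comment> \<open>For \<open>u\<close> supported in \<open>S\<close> the coupling disappears,
      and \<open>R t u\<close> is \<delta> times the squared distance from \<open>u\<close> to
      \<open>t *\<^sub>R x\<close>.\<close>
    have "yT \<bullet> u = 0"
      unfolding inner_vec_def by (intro sum.neutral) (auto simp: yT_nth off S_eq)
    moreover have "restr u = u" using off by (auto simp: vec_eq_iff restr_nth S_eq)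
    ultimately have "\<delta> * ((u - t *\<^sub>R x) \<bullet> (u - t *\<^sub>R x)) \<le> 0"
      using \<open>R t u \<le> 0\<close> by (simp add: R_def h_def)
    then have "(u - t *\<^sub>R x) \<bullet> (u - t *\<^sub>R x) \<le> 0"
      using \<delta> by (simp add: mult_le_0_iff)
    then show "u = t *\<^sub>R x" by (metis eq_iff_diff_eq_0 inner_eq_zero_iff inner_ge_zero order_antisym)
  next
    \<comment> \<open>The dual value is the Lagrangian at \<open>(1, x)\<close>: the diagonal and
      \<open>l\<^sub>1\<close> terms are tight at \<open>x\<close>, and the block form collapses to
      \<open>Y11 - 2 * Y11 + Y11 = 0\<close>.\<close>
    have "p $ i * (x $ i)\<^sup>2 = p $ i" for i
      using x_on(1)[of i] by (cases "i \<in> S") (simp_all add: power2_eq_square p_def)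
    then have "(\<Sum>i\<in>UNIV. p $ i * (x $ i)\<^sup>2) = (\<Sum>i\<in>UNIV. p $ i)"
      by (intro sum.cong refl)
    moreover have "x \<bullet> (E *v x) = m * s\<^sup>2"
    proof -
      have "E $ i $ j * x $ i * x $ j = m * ((x $ i * x $ i) * (x $ j * x $ j))" for i j
        by (cases "i \<in> S \<and> j \<in> S") (auto simp: E_SS x_off)
      then have "x \<bullet> (E *v x)
          = (\<Sum>i\<in>UNIV. \<Sum>j\<in>UNIV. m * ((x $ i * x $ i) * (x $ j * x $ j)))"
        unfolding inner_matrix_vector by (intro sum.cong refl)
      also have "\<dots> = m * ((\<Sum>i\<in>UNIV. x $ i * x $ i) * (\<Sum>j\<in>UNIV. x $ j * x $ j))"
        unfolding sum_product by (simp only: sum_distrib_left)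
      finally show ?thesis using xx by (simp add: inner_vec_def power2_eq_square)
    qed
    moreover have "x \<bullet> (B *v x) = Y11" using Y by (simp add: Bx inner_commute)
    moreover have "yS \<bullet> x = - Y11" using Y by simp
    ultimately show "?q 1 x + \<kappa> + \<mu>2 * real (card (supp x)) + (\<Sum>i\<in>UNIV. p $ i)
        + m * (real (card (supp x)))\<^sup>2 = 0"
      using L_eq[where t = 1 and u = x] xx yTx card_S by (simp add: S_eq s_def)
  qed (use x_vals p0 E_le E_TT \<delta> in \<open>auto simp: R_def S_eq\<close>)
  then show ?thesis using card_S S_eq by simp
qed

end
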